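(* Let $d\ge 2$. For every integer $m\ge 2d$ there exists a probability measure $\mu$ on $\mathbb{R}^d$, absolutely continuous with respect to Lebesgue measure, that cannot be partitioned into $2m$ equal parts by an $m$-fan; that is, for every set of $m$ hyperplanes in $\mathbb{R}^d$ all containing a common $(d-2)$-flat, it is not the case that the complement of their union consists of $2m$ parts each of $\mu$-measure $\frac{1}{2m}$.
   Context: A $(d-2)$-flat is a $(d-2)$-dimensional affine subspace of $\mathbb{R}^d$. An $m$-fan is a set of $m$ hyperplanes in $\mathbb{R}^d$ passing through a common $(d-2)$-flat. *)

theory Defs
  imports "HOL-Probability.Probability"
begin

definition hyperplane :: "'a::euclidean_space set \<Rightarrow> bool" where
  "hyperplane P \<longleftrightarrow> (\<exists>a b. a \<noteq> 0 \<and> P = {x. a \<bullet> x = b})"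

definition codim2_flat :: "'a::euclidean_space set \<Rightarrow> bool" where
  "codim2_flat L \<longleftrightarrow> affine L \<and> L \<noteq> {} \<and> aff_dim L = int DIM('a) - 2"

definition is_fan :: "nat \<Rightarrow> 'a::euclidean_space set set \<Rightarrow> bool" where
  "is_fan m H \<longleftrightarrow> finite H \<and> card H = m \<and> (\<forall>P\<in>H. hyperplane P) \<and>
     (\<exists>L. codim2_flat L \<and> (\<forall>P\<in>H. L \<subseteq> P))"

definition fan_equipartitions :: "'a::euclidean_space measure \<Rightarrow> nat \<Rightarrow> 'a set set \<Rightarrow> bool" where
  "fan_equipartitions \<mu> m H \<longleftrightarrow>
     card (components (UNIV - \<Union>H)) = 2 * m \<and>
     (\<forall>C\<in>components (UNIV - \<Union>H). measure \<mu> C = 1 / (2 * real m))"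

end

theory Submission
  imports Defs
begin

text \<open>
  Densities are taken with respect to the uniform measure on the unit ball and range over the Banach
  space of bounded continuous functions. By Baire's theorem it suffices to write the set of densities
  that some \<open>m\<close>-fan splits into \<open>2m\<close> parts of equal mass as a countable union of nowhere dense sets.

  The hyperplanes of an \<open>m\<close>-fan are the zero sets of affine functions \<open>u\<close>, \<open>v\<close> and \<open>u + \<tau>\<^sub>k v\<close>
  for \<open>m - 2\<close> numbers \<open>\<tau>\<^sub>k\<close>; as \<open>u\<close> and \<open>v\<close> matter only up to scaling, the fan depends on \<open>2d + m - 2\<close>
  parameters. Fix a bound \<open>n\<close> on these parameters and on the degeneracy of the fan, and one point
  \<open>X i\<close> in each of the \<open>2m\<close> parts; countably many choices are enough. Small bumps around
  the \<open>X i\<close> then lie inside the respective parts of every such fan, so adding them to a density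
  shifts the \<open>2m\<close> masses independently. A shift leads to an equipartition only if it lies in the image
  of the parameters, together with the common mass \<open>T\<close>, under a Lipschitz map. This image comes from
  \<open>2d + m - 1 < 2m\<close> dimensions, hence it misses an open set of arbitrarily small shifts.
\<close>

section \<open>Cells of a hyperplane arrangement\<close>

text \<open>Affine functions are coded as vectors, so that they form a Euclidean space whose
  coordinates can be counted and whose norm measures how close two hyperplanes are.\<close>

definition affval :: "'a::euclidean_space \<times> real \<Rightarrow> 'a \<Rightarrow> real" where
  "affval w x = fst w \<bullet> x + snd w"

text \<open>The part is addressed by a point in it rather than by a sign vector, so that the same
  label \<open>x\<close> picks out corresponding parts of different fans. If some \<open>W k\<close>
  with \<open>k < m\<close> vanishes at \<open>x\<close>, the cell is empty.\<close>

definition cell :: "nat \<Rightarrow> (nat \<Rightarrow> 'a::euclidean_space \<times> real) \<Rightarrow> 'a \<Rightarrow> 'a set" where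
  "cell m W x = {y. \<forall>k<m. affval (W k) y * affval (W k) x > 0}"

lemma affval_diff: "affval (u - v) x = affval u x - affval v x"
  and affval_scaleR: "affval (c *\<^sub>R v) x = c * affval v x"
  by (simp_all add: affval_def inner_diff_left algebra_simps)

lemma continuous_on_affval [continuous_intros]: "continuous_on S (affval w)"
  unfolding affval_def by (intro continuous_intros)

lemma affval_measurable [measurable]: "affval w \<in> borel_measurable borel"
  by (intro borel_measurable_continuous_onI continuous_on_affval)

lemma open_cell: "open (cell m W x)"
proof -
  have "cell m W x = (\<Inter>k\<in>{..<m}. {y. affval (W k) y * affval (W k) x > 0})"
    by (auto simp: cell_def)
  moreover have "open {y. affval (W k) y * affval (W k) x > 0}" for k
    by (intro open_Collect_less continuous_intros)
  ultimately show ?thesis by (simp add: open_INT)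
qed

lemma cell_measurable [measurable]: "cell m W x \<in> sets borel"
  by (rule borel_open[OF open_cell])

lemma convex_cell: "convex (cell m W x)"
proof -
  have "affval (W k) y * affval (W k) x > 0 \<longleftrightarrow>
      (affval (W k) x *\<^sub>R fst (W k)) \<bullet> y > - (affval (W k) x * snd (W k))" for k y
    unfolding affval_def[of "W k" y] by (auto simp: algebra_simps)
  then have "cell m W x = (\<Inter>k\<in>{..<m}. {y. (affval (W k) x *\<^sub>R fst (W k)) \<bullet> y > - (affval (W k) x * snd (W k))})"
    by (auto simp: cell_def)
  then show ?thesis by (simp only: convex_INT convex_halfspace_gt)
qed

lemma affval_norm_le:
  assumes "norm x \<le> 1"
  shows "\<bar>affval w x\<bar> \<le> 2 * norm w"
proof -
  have "\<bar>fst w \<bullet> x\<bar> \<le> norm (fst w) * norm x" by (rule Cauchy_Schwarz_ineq2)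
  also have "\<dots> \<le> norm w * 1"
    using assms norm_fst_le[of "fst w" "snd w"] by (intro mult_mono) auto
  finally show ?thesis
    using norm_snd_le[of "snd w" "fst w"] by (simp add: affval_def)
qed

text \<open>No affine function changes sign on a connected set that avoids its zeros, so the
  component lies in the cell. Conversely the cell is convex, avoids all hyperplanes and contains
  \<open>x\<close>, so maximality of the component applies.\<close>

lemma component_eq_cell:
  assumes C: "C \<in> components (UNIV - (\<Union>k<m. {y. affval (W k) y = 0}))" and x: "x \<in> C"
  shows "C = cell m W x"
proof
  let ?U = "UNIV - (\<Union>k<m. {y. affval (W k) y = 0})"
  have CU: "C \<subseteq> ?U" and con: "connected C"
    using C in_components_subset in_components_connected by blast+
  show "C \<subseteq> cell m W x"
  proof (rule subsetI, rule ccontr)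
    fix y assume y: "y \<in> C" "y \<notin> cell m W x"
    then obtain k where k: "k < m" "affval (W k) y * affval (W k) x \<le> 0"
      by (auto simp: cell_def not_less)
    have "connected (affval (W k) ` C)"
      by (intro connected_continuous_image continuous_on_affval con)
    moreover have "affval (W k) x \<in> affval (W k) ` C" "affval (W k) y \<in> affval (W k) ` C"
      using x y by auto
    ultimately have "0 \<in> affval (W k) ` C"
      using k(2) unfolding mult_le_0_iff
      by (meson connected_contains_Icc atLeastAtMost_iff subsetD)
    then show False using CU k(1) by auto
  qed
  have nz: "affval (W k) x \<noteq> 0" if "k < m" for k
    using x CU that by auto
  have "x \<in> cell m W x" using nz by (auto simp: cell_def zero_less_mult_iff)
      (metis linorder_cases)
  moreover have "cell m W x \<subseteq> ?U" by (auto simp: cell_def)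
  ultimately show "cell m W x \<subseteq> C"
    using components_maximal[OF C convex_connected[OF convex_cell]] x by blast
qed

section \<open>Fans as pencils of affine functions\<close>

text \<open>The hyperplanes through the intersection of two given ones form a pencil; up to scaling
  each of them except \<open>v\<close> is \<open>u\<close> plus a multiple of \<open>v\<close>.
  Slots 0 and 1 hold the two generators, which leaves one number for each
  \<open>k \<ge> 2\<close>.\<close>

definition pencil :: "'v::real_vector \<Rightarrow> 'v \<Rightarrow> (nat \<Rightarrow> real) \<Rightarrow> nat \<Rightarrow> 'v" where
  "pencil u v \<tau> k = (if k = 0 then u else if k = 1 then v else u + \<tau> k *\<^sub>R v)"

text \<open>All three vectors lie in the orthogonal complement of the direction space of
  \<open>L\<close>. That complement has dimension 2, so the independent vectors \<open>a\<close> and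
  \<open>b\<close> span it.\<close>

lemma orthogonal_direction_span:
  fixes L :: "'a::euclidean_space set"
  assumes L: "codim2_flat L" "p \<in> L"
    and perp: "\<And>x. x \<in> L \<Longrightarrow> a \<bullet> (x - p) = 0" "\<And>x. x \<in> L \<Longrightarrow> b \<bullet> (x - p) = 0"
      "\<And>x. x \<in> L \<Longrightarrow> c \<bullet> (x - p) = 0"
    and ab: "a \<noteq> 0" "\<And>r. b \<noteq> r *\<^sub>R a"
  shows "\<exists>s t. c = s *\<^sub>R a + t *\<^sub>R b"
proof -
  define D where "D = (\<lambda>x. x - p) ` L"
  define A where "A = {y \<in> UNIV. \<forall>x \<in> D. orthogonal x y}"
  have "affine L" using L by (simp add: codim2_flat_def)
  have "subspace D" unfolding D_def using affine_diffs_subspace_subtract[OF \<open>affine L\<close> L(2)] .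
  then have dA: "dim A + dim D = DIM('a)"
    unfolding A_def using dim_subspace_orthogonal_to_vectors[of D UNIV] by simp
  have "int (dim D) = int DIM('a) - 2"
    unfolding D_def using aff_dim_dim_affine_diffs[OF \<open>affine L\<close> L(2)] L by (simp add: codim2_flat_def)
  with dA have "dim A = 2" by linarith
  have mem: "a \<in> A" "b \<in> A" "c \<in> A"
    using perp by (auto simp: A_def D_def orthogonal_def inner_commute)
  have nin: "b \<notin> span {a}" using ab(2) by (auto simp: span_singleton)
  then have "b \<noteq> a" by (metis insertI1 span_base)
  have "independent {b, a}"
    using nin ab(1) by (simp add: independent_insert)
  moreover have "card {b, a} = 2" using \<open>b \<noteq> a\<close> by simp
  ultimately have "A \<subseteq> span {b, a}"
    using mem \<open>dim A = 2\<close> by (intro card_ge_dim_independent) auto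
  then have "c \<in> span {b, a}" using mem by blast
  then obtain t where "c - t *\<^sub>R b \<in> span {a}" using span_breakdown_eq by blast
  then obtain s where "c - t *\<^sub>R b = s *\<^sub>R a" by (auto simp: span_singleton)
  then have "c = s *\<^sub>R a + t *\<^sub>R b" by (simp add: algebra_simps)
  then show ?thesis by blast
qed

text \<open>The normals lie in a plane spanned by two of them. The offsets obey the same linear
  relation because all hyperplanes pass through a point \<open>p\<close> of the flat, so the
  relation holds for the affine functions. Scaling these does not move their zero sets.\<close>

lemma fan_as_pencil:
  fixes H :: "'a::euclidean_space set set"
  assumes fan: "is_fan m H" and m: "m \<ge> 2"
  shows "\<exists>u v \<tau> c d. c \<in> Basis \<and> d \<in> Basis \<and> u \<bullet> c = 1 \<and> v \<bullet> d = 1 \<and>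
    (\<forall>k<m. fst (pencil u v \<tau> k) \<noteq> 0) \<and>
    H = (\<lambda>k. {x. affval (pencil u v \<tau> k) x = 0}) ` {..<m}"
proof -
  obtain L where L: "codim2_flat L" "\<And>P. P \<in> H \<Longrightarrow> L \<subseteq> P"
    and H: "finite H" "card H = m" "\<And>P. P \<in> H \<Longrightarrow> hyperplane P"
    using fan by (auto simp: is_fan_def)
  obtain e where e: "bij_betw e {0..<m} H"
    using ex_bij_betw_nat_finite[OF H(1)] H(2) by auto
  have eH: "e k \<in> H" if "k < m" for k using e that by (auto simp: bij_betw_def)
  have einj: "e i \<noteq> e j" if "i < m" "j < m" "i \<noteq> j" for i j
    using inj_onD[OF bij_betw_imp_inj_on[OF e], of i j] that by auto
  have "\<forall>k. \<exists>a b. k < m \<longrightarrow> a \<noteq> 0 \<and> e k = {x. a \<bullet> x = b}"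
    using H(3)[OF eH] unfolding hyperplane_def by blast
  then obtain a b where ab: "\<And>k. k < m \<Longrightarrow> a k \<noteq> 0" "\<And>k. k < m \<Longrightarrow> e k = {x. a k \<bullet> x = b k}"
    by metis
  obtain p where p: "p \<in> L" using L(1) by (auto simp: codim2_flat_def)
  have inL: "a k \<bullet> x = b k" if "x \<in> L" "k < m" for k x
    using L(2)[OF eH[OF that(2)]] ab(2)[OF that(2)] that(1) by blast
  have perp: "a k \<bullet> (x - p) = 0" if "x \<in> L" "k < m" for k x
    using inL[OF that] inL[OF p that(2)] by (simp add: inner_diff_right)
  have b: "b k = a k \<bullet> p" if "k < m" for k using inL[OF p that] by simp
  \<comment> \<open>Hyperplanes through \<open>p\<close> with parallel normals coincide, while
    \<open>e\<close> is injective.\<close>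
  have nonpar: "a j \<noteq> r *\<^sub>R a i" if "i < m" "j < m" "i \<noteq> j" for i j r
  proof
    assume r: "a j = r *\<^sub>R a i"
    then have "r \<noteq> 0" using ab(1)[OF that(2)] by auto
    then have "e j = e i"
      using r that by (auto simp: ab(2) b)
    then show False using einj that by metis
  qed
  have m01: "0 < m" "1 < m" using m by auto
  define w where "w k = (a k, - b k)" for k
  have ew: "e k = {x. affval (w k) x = 0}" if "k < m" for k
    using that by (auto simp: ab(2) w_def affval_def)
  have w0: "w k \<noteq> 0" if "k < m" for k using ab(1)[OF that] by (auto simp: w_def zero_prod_def)
  obtain c where c: "c \<in> Basis" "w 0 \<bullet> c \<noteq> 0" using w0[OF m01(1)] euclidean_all_zero_iff by blast
  obtain d where d: "d \<in> Basis" "w 1 \<bullet> d \<noteq> 0" using w0[OF m01(2)] euclidean_all_zero_iff by blast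
  define u where "u = w 0 /\<^sub>R (w 0 \<bullet> c)"
  define v where "v = w 1 /\<^sub>R (w 1 \<bullet> d)"
  have "\<exists>r \<tau>. r \<noteq> 0 \<and> w k = r *\<^sub>R (u + \<tau> *\<^sub>R v)" if k: "k < m" "k \<noteq> 0" "k \<noteq> 1" for k
  proof -
    obtain s t where st: "a k = s *\<^sub>R a 0 + t *\<^sub>R a 1"
      using orthogonal_direction_span[OF L(1) p perp[OF _ m01(1)] perp[OF _ m01(2)] perp[OF _ k(1)]
        ab(1)[OF m01(1)] nonpar[OF m01]] by auto
    then have "b k = s * b 0 + t * b 1" using k(1) m01 by (simp add: b inner_add_left)
    with st have w: "w k = s *\<^sub>R w 0 + t *\<^sub>R w 1" by (simp add: w_def)
    \<comment> \<open>With \<open>s = 0\<close> the normals \<open>a k\<close> and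
      \<open>a 1\<close> would be parallel.\<close>
    have "s \<noteq> 0" using st nonpar[of 1 k t] k m01 by auto
    have uv: "w 0 = (w 0 \<bullet> c) *\<^sub>R u" "w 1 = (w 1 \<bullet> d) *\<^sub>R v" using c d by (simp_all add: u_def v_def)
    \<comment> \<open>Dividing by the coefficient of \<open>u\<close> leaves a single free number
      per further hyperplane.\<close>
    define r where "r = s * (w 0 \<bullet> c)"
    have "r \<noteq> 0" using \<open>s \<noteq> 0\<close> c by (simp add: r_def)
    moreover have "w k = r *\<^sub>R (u + (t * (w 1 \<bullet> d) / r) *\<^sub>R v)"
    proof -
      have "w k = s *\<^sub>R ((w 0 \<bullet> c) *\<^sub>R u) + t *\<^sub>R ((w 1 \<bullet> d) *\<^sub>R v)" using w uv by metis
      then show ?thesis using \<open>r \<noteq> 0\<close> by (simp add: r_def scaleR_add_right)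
    qed
    ultimately show ?thesis by blast
  qed
  then obtain r \<tau> where rt: "\<And>k. k < m \<Longrightarrow> k \<noteq> 0 \<Longrightarrow> k \<noteq> 1 \<Longrightarrow> r k \<noteq> (0::real) \<and> w k = r k *\<^sub>R (u + \<tau> k *\<^sub>R v)"
    by metis
  have pen: "\<exists>r. r \<noteq> 0 \<and> w k = r *\<^sub>R pencil u v \<tau> k" if "k < m" for k
  proof -
    consider "k = 0" | "k = 1" | "k \<noteq> 0" "k \<noteq> 1" by blast
    then show ?thesis
    proof cases
      case 1 then show ?thesis using c by (intro exI[of _ "w 0 \<bullet> c"]) (simp add: pencil_def u_def)
    next
      case 2 then show ?thesis using d by (intro exI[of _ "w 1 \<bullet> d"]) (simp add: pencil_def v_def)
    next
      case 3 then show ?thesis using rt[OF that] by (intro exI[of _ "r k"]) (simp add: pencil_def)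
    qed
  qed
  have "fst (pencil u v \<tau> k) \<noteq> 0" if k: "k < m" for k
  proof -
    obtain r where "w k = r *\<^sub>R pencil u v \<tau> k" using pen[OF k] by blast
    then have "a k = r *\<^sub>R fst (pencil u v \<tau> k)" by (metis w_def fst_conv fst_scaleR)
    then show ?thesis using ab(1)[OF k] by auto
  qed
  moreover have "e k = {x. affval (pencil u v \<tau> k) x = 0}" if k: "k < m" for k
  proof -
    obtain r where "r \<noteq> 0" "w k = r *\<^sub>R pencil u v \<tau> k" using pen[OF k] by blast
    then show ?thesis by (simp add: ew[OF k] affval_scaleR)
  qed
  then have "H = (\<lambda>k. {x. affval (pencil u v \<tau> k) x = 0}) ` {..<m}"
    using e by (auto simp: bij_betw_def atLeast0LessThan intro!: image_eqI)
  moreover have "u \<bullet> c = 1" "v \<bullet> d = 1" using c d by (simp_all add: u_def v_def)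
  ultimately show ?thesis using c(1) d(1) by blast
qed

section \<open>Slabs in the unit ball\<close>

abbreviation unif_ball :: "'a::euclidean_space measure" where
  "unif_ball \<equiv> uniform_measure lborel (cball 0 1)"

lemma lborel_unit_ball:
  "emeasure lborel (cball (0::'a::euclidean_space) 1) \<noteq> 0"
  "emeasure lborel (cball (0::'a) 1) \<noteq> \<infinity>"
proof -
  show "emeasure lborel (cball (0::'a) 1) \<noteq> \<infinity>"
    using emeasure_lborel_cball_finite[of "0::'a" 1] by auto
  have "measure lborel (cball (0::'a) 1) > 0"
    using content_cball_pos[of 1 "0::'a"] by (simp add: measure_completion)
  then show "emeasure lborel (cball (0::'a) 1) \<noteq> 0"
    by (auto simp: measure_def)
qed

lemma prob_space_unif_ball: "prob_space unif_ball"
  using lborel_unit_ball by (rule prob_space_uniform_measure)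

interpretation unif_ball: prob_space "unif_ball :: 'a::euclidean_space measure"
  by (rule prob_space_unif_ball)

lemma measure_unif_ball:
  fixes A :: "'a::euclidean_space set"
  assumes "A \<in> sets borel"
  shows "measure unif_ball A = measure lborel (cball 0 1 \<inter> A) / measure lborel (cball (0::'a) 1)"
  using lborel_unit_ball assms by (intro measure_uniform_measure) auto

text \<open>A small change of an affine function alters its sign only in a thin slab around its zero
  set; this bound turns that into a Lipschitz estimate for masses. The product form avoids dividing
  by \<open>norm (fst w)\<close>, which may be zero.\<close>

lemma unif_ball_slab:
  "\<exists>K>0. \<forall>(w::'a::euclidean_space \<times> real) \<delta>. \<delta> > 0 \<longrightarrow>
     measure unif_ball {x. \<bar>affval w x\<bar> \<le> \<delta>} * norm (fst w) \<le> K * \<delta>"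
proof -
  define V :: "real \<Rightarrow> real" where "V r = measure lborel (cball (0::'a) r)" for r
  have Vpos: "V r > 0" if "r > 0" for r
    using that content_cball_pos[of r "0::'a"] by (simp add: V_def measure_completion)
  have cb: "cball (0::'a) r \<in> fmeasurable lborel" for r
    using emeasure_lborel_cball_finite[of "0::'a" r] by (intro fmeasurableI) auto
  have V12: "V 1 \<le> V 2" unfolding V_def
    by (rule measure_mono_fmeasurable) (auto intro: cb)
  have "measure unif_ball {x. \<bar>affval w x\<bar> \<le> \<delta>} * norm (fst w) \<le> (6 * V 2 / V 1) * \<delta>"
    if d: "\<delta> > 0" for w :: "'a \<times> real" and \<delta>
  proof (cases "norm (fst w) \<le> 3 * \<delta>")
    case True
    \<comment> \<open>For a wide slab the trivial bound 1 on a probability is enough.\<close>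
    have "measure unif_ball {x. \<bar>affval w x\<bar> \<le> \<delta>} \<le> 1"
      by (rule unif_ball.prob_le_1)
    then have "measure unif_ball {x. \<bar>affval w x\<bar> \<le> \<delta>} * norm (fst w) \<le> 1 * (3 * \<delta>)"
      using True by (intro mult_mono) auto
    also have "\<dots> \<le> (6 * V 2 / V 1) * \<delta>"
      using V12 Vpos[of 1] d by (simp add: field_simps)
    finally show ?thesis .
  next
    case False
    \<comment> \<open>Packing: about \<open>a / (3 \<delta>)\<close> disjoint translates of the slab fit into the ball of radius 2.\<close>
    define a where "a = norm (fst w)"
    define u where "u = fst w /\<^sub>R a"
    \<comment> \<open>A shift by \<open>t\<close> along \<open>u\<close> raises the affine function
      by \<open>3 * \<delta>\<close>, more than the spread \<open>2 * \<delta>\<close> of its values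
      on the slab. At most \<open>1 / t\<close> such shifts move the unit ball by at most 1.\<close>
    define t where "t = 3 * \<delta> / a"
    define S where "S = cball 0 1 \<inter> {x. \<bar>affval w x\<bar> \<le> \<delta>}"
    define P where "P = nat \<lfloor>1 / t\<rfloor>"
    have a: "a > 0" "3 * \<delta> < a" using False d by (auto simp: a_def)
    have t: "t > 0" "t < 1" using a d by (auto simp: t_def)
    have P1: "real P * t \<le> 1" proof -
      have "real P \<le> 1 / t" unfolding P_def using t by simp
      then show ?thesis using t by (simp add: pos_le_divide_eq)
    qed
    have P2: "real P \<ge> 1 / (2 * t)"
    proof -
      \<comment> \<open>Both 1 and \<open>1 / t - 1\<close> bound \<open>P\<close> from below, and
        their average is \<open>1 / (2 * t)\<close>.\<close>
      have *: "1 / t > 1" using t by simp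
      then have "real P > 1 / t - 1" unfolding P_def by linarith
      moreover have "1 \<le> P" unfolding P_def using * by (intro le_nat_floor) simp
      moreover have "1 / (2 * t) = (1 / t) / 2" by simp
      ultimately show ?thesis by linarith
    qed
    have nu: "norm u = 1" using a by (simp add: u_def a_def)
    have wu: "fst w \<bullet> u = a" using a by (simp add: u_def a_def dot_square_norm power2_eq_square)
    define T where "T k = (+) ((real k * t) *\<^sub>R u) ` S" for k
    have "compact S" unfolding S_def
      by (intro compact_Int_closed compact_cball closed_Collect_le continuous_intros)
    then have cT: "compact (T k)" for k unfolding T_def by (rule compact_translation)
    have TV: "T k \<subseteq> cball 0 2" if "k < P" for k
    proof -
      have "norm ((real k * t) *\<^sub>R u + x) \<le> 2" if "norm x \<le> 1" for x
      proof -
        have "real k * t \<le> real P * t" using \<open>k < P\<close> t by (intro mult_right_mono) auto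
        then have "real k * t \<le> 1" using P1 by linarith
        then have "norm ((real k * t) *\<^sub>R u) \<le> 1" using nu t by simp
        then show ?thesis using norm_triangle_ineq[of "(real k * t) *\<^sub>R u" x] that by linarith
      qed
      then show ?thesis by (auto simp: T_def S_def)
    qed
    have aff: "\<bar>affval w y - 3 * \<delta> * real k\<bar> \<le> \<delta>" if "y \<in> T k" for y k
    proof -
      obtain x where x: "y = (real k * t) *\<^sub>R u + x" "\<bar>affval w x\<bar> \<le> \<delta>"
        using \<open>y \<in> T k\<close> by (auto simp: T_def S_def)
      have "real k * t * a = 3 * \<delta> * real k" using a unfolding t_def by (simp only: times_divide_eq_right) simp
      moreover have "affval w y = affval w x + real k * t * a"
        using x(1) by (simp add: affval_def inner_add_right wu)
      ultimately show ?thesis using x(2) by linarith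
    qed
    have disj: "disjoint_family_on T {..<P}"
      unfolding disjoint_family_on_def
    proof (intro ballI impI equals0I)
      fix i j y assume "i \<noteq> j" "y \<in> T i \<inter> T j"
      then have "\<bar>3 * \<delta> * real i - 3 * \<delta> * real j\<bar> \<le> 2 * \<delta>"
        using aff[of y i] aff[of y j] by auto
      then have "3 * \<delta> * \<bar>real i - real j\<bar> \<le> 2 * \<delta>"
        using d by (simp add: abs_mult flip: right_diff_distrib)
      moreover have "\<bar>real i - real j\<bar> \<ge> 1" using \<open>i \<noteq> j\<close> by linarith
      ultimately have "3 * \<delta> * 1 \<le> 2 * \<delta>"
        using d by (meson mult_left_mono order_trans mult_nonneg_nonneg less_imp_le zero_le_numeral)
      then show False using d by simp
    qed
    have mT: "measure lborel (T k) = measure lborel S" for k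
    proof -
      have "measure lebesgue (T k) = measure lebesgue S" unfolding T_def by (rule measure_translation)
      then show ?thesis using cT[of k] \<open>compact S\<close> by (simp add: measure_completion borel_compact)
    qed
    have "real P * measure lborel S = (\<Sum>k<P. measure lborel (T k))" by (simp add: mT)
    also have "\<dots> = measure lborel (\<Union>k<P. T k)"
    proof (intro measure_finite_Union[symmetric] disj)
      show "emeasure lborel (T k) \<noteq> \<infinity>" for k
        using emeasure_bounded_finite[OF compact_imp_bounded[OF cT]] by (simp add: less_top)
    qed (use cT in \<open>auto simp: borel_compact\<close>)
    also have "\<dots> \<le> V 2" unfolding V_def
      using TV cT by (intro measure_mono_fmeasurable) (auto intro!: cb borel_compact sets.finite_UN)
    finally have "real P * measure lborel S \<le> V 2" .
    moreover have "1 / (2 * t) * measure lborel S \<le> real P * measure lborel S"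
      using P2 by (intro mult_right_mono) auto
    ultimately have "1 / (2 * t) * measure lborel S \<le> V 2" by linarith
    then have "measure lborel S * a \<le> 6 * V 2 * \<delta>"
      using a d by (simp add: t_def field_simps)
    then have "measure lborel S * a / V 1 \<le> 6 * V 2 * \<delta> / V 1"
      using Vpos[of 1] by (intro divide_right_mono) auto
    moreover have "measure unif_ball {x. \<bar>affval w x\<bar> \<le> \<delta>} = measure lborel S / V 1"
      by (simp add: measure_unif_ball V_def S_def)
    ultimately show ?thesis by (simp add: a_def)
  qed
  then show ?thesis using Vpos[of 1] Vpos[of 2] by (intro exI[of _ "6 * V 2 / V 1"]) auto
qed

section \<open>Lipschitz images from lower dimension\<close>

lemma floor_eq_imp_close:
  fixes x y N :: real
  assumes "\<lfloor>N * x\<rfloor> = \<lfloor>N * y\<rfloor>" "N > 0"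
  shows "\<bar>x - y\<bar> \<le> 1 / N"
proof -
  have "\<bar>N * x - N * y\<bar> < 1" using assms(1) by linarith
  then have "N * \<bar>x - y\<bar> < 1" using assms(2) by (simp add: abs_mult flip: right_diff_distrib)
  then show ?thesis using assms(2) by (simp add: field_simps)
qed

text \<open>
  The parameters of \<open>p\<close> are the \<open>co i p\<close>. Pigeonhole: a grid of \<open>G\<^sup>q\<close> points in the box against
  \<open>O(G\<^bsup>card I\<^esup>)\<close> cells of side \<open>1 / N\<close> in parameter space, each of whose images is too small to
  come near two grid points.
\<close>
lemma lipschitz_image_misses_box:
  fixes S :: "'p set" and I :: "'i set" and co :: "'i \<Rightarrow> 'p \<Rightarrow> real" and g :: "nat \<Rightarrow> 'p \<Rightarrow> real"
    and b :: nat
  assumes I: "finite I" "card I < q" and bnd: "\<And>p i. p \<in> S \<Longrightarrow> i \<in> I \<Longrightarrow> \<bar>co i p\<bar> \<le> real b"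
    and h0: "h0 > 0" and \<eta>: "\<eta> > 0"
    and lip: "\<And>p p' h j. p \<in> S \<Longrightarrow> p' \<in> S \<Longrightarrow> 0 < h \<Longrightarrow> h < h0 \<Longrightarrow>
      (\<And>i. i \<in> I \<Longrightarrow> \<bar>co i p - co i p'\<bar> \<le> h) \<Longrightarrow> j < q \<Longrightarrow> \<bar>g j p - g j p'\<bar> \<le> A * h"
  shows "\<exists>s \<rho>. (\<forall>j<q. 0 \<le> s j \<and> s j \<le> \<eta>) \<and> \<rho> > 0 \<and> (\<forall>p\<in>S. \<exists>j<q. \<bar>s j - g j p\<bar> \<ge> \<rho>)"
proof -
  define D where "D = card I"
  \<comment> \<open>Chosen so that parameters at distance \<open>1 / (Q * G)\<close> have images at
    distance at most \<open>\<eta> / (2 * G)\<close>, half of the grid spacing.\<close>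
  define Q :: nat where "Q = nat \<lceil>2 * \<bar>A\<bar> / \<eta>\<rceil> + 1"
  have Q: "2 * A \<le> real Q * \<eta>" "Q > 0"
  proof -
    have "2 * \<bar>A\<bar> / \<eta> \<le> real Q" unfolding Q_def by linarith
    then show "2 * A \<le> real Q * \<eta>" using \<eta> by (simp add: field_simps)
  qed (simp add: Q_def)
  \<comment> \<open>A coordinate bounded by \<open>b\<close> takes at most
    \<open>2 * b * N + 1 \<le> M * G\<close> rounded values. Thus \<open>G > M ^ D\<close> makes the
    \<open>G ^ q\<close> grid points outnumber the parameter cells; the other summand of
    \<open>G\<close> pushes the side \<open>1 / N\<close> below \<open>h0\<close>.\<close>
  define M where "M = 2 * b * Q + 1"
  define G :: nat where "G = M ^ D + nat \<lceil>1 / h0\<rceil> + 1"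
  define N where "N = Q * G"
  have G: "G > 0" "G > M ^ D" by (auto simp: G_def)
  have "real G > 1 / h0" proof -
    have "1 / h0 \<le> real (nat \<lceil>1 / h0\<rceil>)" by (rule of_nat_ceiling)
    moreover have "nat \<lceil>1 / h0\<rceil> < G" by (simp add: G_def)
    ultimately show ?thesis by linarith
  qed
  also have "real G \<le> real N" using Q(2) by (simp add: N_def del: of_nat_mult)
  finally have N: "1 / real N < h0" "real N > 0"
    using h0 G Q(2) by (simp_all add: field_simps N_def)
  \<comment> \<open>Two grid points within \<open>\<rho>\<close> of images of the same parameter
    cell would differ in each coordinate by less than \<open>2 * \<rho> + \<eta> / (2 * G)\<close>,
    which is the grid spacing \<open>\<eta> / G\<close>.\<close>
  define \<rho> where "\<rho> = \<eta> / (4 * real G)"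
  have \<rho>: "\<rho> > 0" using \<eta> G by (simp add: \<rho>_def)
  define pt where "pt w j = \<eta> * real (w j) / real G" for w :: "nat \<Rightarrow> nat" and j
  define Gr where "Gr = PiE {..<q} (\<lambda>_. {..<G})"
  have "\<exists>w\<in>Gr. \<forall>p\<in>S. \<exists>j<q. \<bar>pt w j - g j p\<bar> \<ge> \<rho>"
  proof (rule ccontr)
    assume "\<not> ?thesis"
    then have "\<forall>w\<in>Gr. \<exists>p\<in>S. \<forall>j<q. \<bar>pt w j - g j p\<bar> < \<rho>" by (meson not_le)
    then obtain P where P: "\<And>w. w \<in> Gr \<Longrightarrow> P w \<in> S" "\<And>w j. w \<in> Gr \<Longrightarrow> j < q \<Longrightarrow> \<bar>pt w j - g j (P w)\<bar> < \<rho>"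
      by metis
    \<comment> \<open>The parameter cell containing \<open>P w\<close>, whose image comes near the
      grid point \<open>w\<close>.\<close>
    define code where "code w = (\<lambda>i\<in>I. \<lfloor>real N * co i (P w)\<rfloor>)" for w
    define Cs where "Cs = PiE I (\<lambda>_. {- int (b * N)..int (b * N)})"
    have "code ` Gr \<subseteq> Cs"
    proof (clarsimp simp: code_def Cs_def)
      fix w i assume "w \<in> Gr" "i \<in> I"
      then have "\<bar>co i (P w)\<bar> \<le> real b" using bnd P by blast
      then have "real N * \<bar>co i (P w)\<bar> \<le> real N * real b" using N by (intro mult_left_mono) auto
      then have "\<bar>real N * co i (P w)\<bar> \<le> real N * real b" by (simp add: abs_mult)
      then have "real_of_int (- int (b * N)) \<le> real N * co i (P w)" "real N * co i (P w) \<le> real_of_int (int (b * N))"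
        by (auto simp: abs_le_iff mult.commute)
      then show "- (int b * int N) \<le> \<lfloor>real N * co i (P w)\<rfloor> \<and> \<lfloor>real N * co i (P w)\<rfloor> \<le> int b * int N"
        by (auto simp: le_floor_iff floor_le_iff)
    qed
    moreover have "inj_on code Gr"
    proof (rule inj_onI, rule ccontr)
      fix w w' assume w: "w \<in> Gr" "w' \<in> Gr" "code w = code w'" "w \<noteq> w'"
      then obtain j where j: "j < q" "w j \<noteq> w' j"
        unfolding Gr_def by (metis PiE_ext lessThan_iff)
      have "\<bar>co i (P w) - co i (P w')\<bar> \<le> 1 / real N" if "i \<in> I" for i
        using fun_cong[OF w(3), of i] that N(2) by (intro floor_eq_imp_close) (auto simp: code_def)
      then have "\<bar>g j (P w) - g j (P w')\<bar> \<le> A * (1 / real N)"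
        using N P(1) w j by (intro lip) auto
      also have "\<dots> \<le> \<eta> / (2 * real G)"
        using Q G by (simp add: N_def field_simps)
      finally have "\<bar>pt w j - pt w' j\<bar> < \<eta> / real G"
        using P(2)[OF w(1) j(1)] P(2)[OF w(2) j(1)] by (simp add: \<rho>_def field_simps)
      moreover have "\<bar>pt w j - pt w' j\<bar> = \<eta> / real G * \<bar>real (w j) - real (w' j)\<bar>"
      proof -
        have "pt w j - pt w' j = \<eta> / real G * (real (w j) - real (w' j))"
          by (simp add: pt_def right_diff_distrib diff_divide_distrib)
        then show ?thesis using \<eta> by (simp add: abs_mult)
      qed
      moreover have "1 \<le> \<bar>real (w j) - real (w' j)\<bar>" using j(2) by linarith
      then have "\<eta> / real G * 1 \<le> \<eta> / real G * \<bar>real (w j) - real (w' j)\<bar>"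
        using \<eta> G by (intro mult_left_mono) auto
      ultimately show False by linarith
    qed
    moreover have "finite Cs" unfolding Cs_def using I by (intro finite_PiE) auto
    ultimately have "card Gr \<le> card Cs" by (metis card_inj_on_le)
    moreover have "card Gr = G ^ q" by (simp add: Gr_def card_PiE)
    moreover have "card Cs = (2 * b * N + 1) ^ D"
    proof -
      have "card {- int (b * N)..int (b * N)} = 2 * b * N + 1"
        by (simp add: nat_add_distrib nat_mult_distrib)
      then show ?thesis using I by (simp only: Cs_def card_PiE D_def prod_constant)
    qed
    moreover have "(2 * b * N + 1) ^ D \<le> (M * G) ^ D"
      using G by (intro power_mono) (auto simp: M_def N_def algebra_simps)
    moreover have "G ^ (D + 1) \<le> G ^ q"
      using I G by (intro power_increasing) (auto simp: D_def)
    ultimately have "G ^ (D + 1) \<le> M ^ D * G ^ D" by (simp only: power_mult_distrib)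
    then have "G \<le> M ^ D" using G by simp
    then show False using G by simp
  qed
  then obtain w where w: "w \<in> Gr" "\<forall>p\<in>S. \<exists>j<q. \<bar>pt w j - g j p\<bar> \<ge> \<rho>" by blast
  have "0 \<le> pt w j \<and> pt w j \<le> \<eta>" if "j < q" for j
  proof -
    have "w j < G" using w(1) that by (auto simp: Gr_def)
    then have "\<eta> * real (w j) \<le> \<eta> * real G" using \<eta> by (intro mult_left_mono) auto
    then show ?thesis using \<eta> G by (auto simp: pt_def field_simps)
  qed
  then show ?thesis using w \<rho> by blast
qed

section \<open>Mass of a part as a functional of the density\<close>

text \<open>Kept unnormalised so that it is linear in the density; division by the total mass is
  postponed to the final measure.\<close>

definition mass :: "('a::euclidean_space \<Rightarrow>\<^sub>C real) \<Rightarrow> 'a set \<Rightarrow> real" where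
  "mass f C = (\<integral>x. indicator C x * f x \<partial>unif_ball)"

lemma integrable_indicator_bcontfun:
  fixes f :: "'a::euclidean_space \<Rightarrow>\<^sub>C real"
  assumes "C \<in> sets borel"
  shows "integrable unif_ball (\<lambda>x. indicator C x * f x)"
proof (rule unif_ball.integrable_const_bound[of _ "norm f"])
  have [measurable]: "apply_bcontfun f \<in> borel_measurable borel"
    by (intro borel_measurable_continuous_onI continuous_on_apply_bcontfun)
  show "(\<lambda>x. indicator C x * f x) \<in> borel_measurable unif_ball"
    using assms by measurable
  show "AE x in unif_ball. norm (indicator C x * f x) \<le> norm f"
    using norm_bounded[of f] by (auto simp: indicator_def)
qed

lemma integrable_unif_ball_indicator:
  "C \<in> sets borel \<Longrightarrow> integrable unif_ball (indicat_real C)"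
  by (rule unif_ball.integrable_const_bound[of _ 1]) auto

lemma mass_add: "C \<in> sets borel \<Longrightarrow> mass (f + g) C = mass f C + mass g C"
  unfolding mass_def
  by (simp add: integrable_indicator_bcontfun distrib_left plus_bcontfun.rep_eq)

lemma mass_scaleR: "mass (c *\<^sub>R f) C = c * mass f C"
  unfolding mass_def by (simp add: mult.left_commute scaleR_bcontfun.rep_eq)

lemma mass_diff: "C \<in> sets borel \<Longrightarrow> mass (f - g) C = mass f C - mass g C"
  using mass_add[of C f "(-1) *\<^sub>R g"] mass_scaleR[of "-1" g C] by simp

lemma mass_sum:
  assumes "finite J" "C \<in> sets borel"
  shows "mass (\<Sum>j\<in>J. f j) C = (\<Sum>j\<in>J. mass (f j) C)"
  using assms
proof (induction rule: finite_induct)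
  case empty
  show ?case using mass_scaleR[of 0 0 C] by simp
qed (simp add: mass_add)

lemma abs_mass_le:
  fixes f :: "'a::euclidean_space \<Rightarrow>\<^sub>C real"
  assumes "C \<in> sets borel"
  shows "\<bar>mass f C\<bar> \<le> norm f"
proof -
  have "\<bar>mass f C\<bar> \<le> (\<integral>x. norm (indicator C x * f x) \<partial>unif_ball)"
    unfolding mass_def real_norm_def[symmetric] by (rule integral_norm_bound)
  also have "\<dots> \<le> (\<integral>x. norm f \<partial>(unif_ball :: 'a measure))"
    using integrable_indicator_bcontfun[OF assms, of f] norm_bounded[of f]
    by (intro integral_mono integrable_norm) (auto simp: indicator_def)
  also have "\<dots> = measure (unif_ball :: 'a measure) (space unif_ball) * norm f" by simp
  also have "\<dots> = norm f" by (simp only: unif_ball.prob_space mult_1)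
  finally show ?thesis .
qed

lemma AE_unif_ball: "AE x in (unif_ball :: 'a::euclidean_space measure). norm x \<le> 1"
  by (rule AE_uniform_measureI) auto

text \<open>On the unit ball corresponding affine functions differ by at most
  \<open>2 * \<delta>\<close>. Hence the signs at the label \<open>x\<close> agree, and so do the
  signs at every \<open>y\<close> outside the slabs where some \<open>W k\<close> is at most
  \<open>2 * \<delta>\<close> in absolute value. The two cells therefore differ, within the ball,
  only inside \<open>m\<close> slabs, whose measure is controlled by the lower bound on the
  normals.\<close>

lemma mass_cell_close:
  fixes W W' :: "nat \<Rightarrow> 'a::euclidean_space \<times> real"
  assumes K: "\<And>(w::'a \<times> real) \<delta>. \<delta> > 0 \<Longrightarrow> measure unif_ball {x. \<bar>affval w x\<bar> \<le> \<delta>} * norm (fst w) \<le> K * \<delta>"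
    and close: "\<And>k. k < m \<Longrightarrow> norm (W k - W' k) \<le> \<delta>" and \<delta>: "\<delta> > 0"
    and away: "\<And>k. k < m \<Longrightarrow> \<bar>affval (W k) x\<bar> > 2 * \<delta>" and x: "norm x \<le> 1"
    and steep: "\<And>k. k < m \<Longrightarrow> norm (fst (W k)) \<ge> 1 / n" and n: "n > 0"
  shows "\<bar>mass f (cell m W x) - mass f (cell m W' x)\<bar> \<le> norm f * (real m * (K * n * (2 * \<delta>)))"
proof -
  let ?slab = "\<lambda>k. {y. \<bar>affval (W k) y\<bar> \<le> 2 * \<delta>}"
  have aff: "\<bar>affval (W k) y - affval (W' k) y\<bar> \<le> 2 * \<delta>" if "k < m" "norm y \<le> 1" for k y
    using affval_norm_le[OF that(2), of "W k - W' k"] close[OF that(1)] by (simp add: affval_diff)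
  have sgn: "(affval (W k) y * affval (W k) x > 0) = (affval (W' k) y * affval (W' k) x > 0)"
    if "k < m" "norm y \<le> 1" "y \<notin> ?slab k" for k y
    using aff[OF that(1,2)] aff[OF that(1) x] away[OF that(1)] that(3)
    by (auto simp: zero_less_mult_iff abs_if split: if_splits)
  have pw: "norm ((indicator (cell m W x) y - indicator (cell m W' x) y) * f y) \<le> norm f * (\<Sum>k<m. indicator (?slab k) y)"
    if y: "norm y \<le> 1" for y
  proof (cases "\<exists>k<m. y \<in> ?slab k")
    case True
    then obtain k where k: "k < m" "y \<in> ?slab k" by blast
    have "(1::real) = (\<Sum>k\<in>{k}. indicator (?slab k) y)" using k by simp
    also have "\<dots> \<le> (\<Sum>k<m. indicator (?slab k) y)" using k by (intro sum_mono2) auto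
    finally have "norm f * 1 \<le> norm f * (\<Sum>k<m. indicator (?slab k) y)" by (intro mult_left_mono) auto
    moreover have "norm ((indicator (cell m W x) y - indicator (cell m W' x) y) * f y) \<le> norm f"
      using norm_bounded[of f y] by (auto simp: indicator_def)
    ultimately show ?thesis by linarith
  next
    case False
    then have "y \<in> cell m W x \<longleftrightarrow> y \<in> cell m W' x"
      using sgn[OF _ y] by (auto simp: cell_def)
    then have "norm ((indicator (cell m W x) y - indicator (cell m W' x) y) * f y) = 0"
      by (simp add: indicator_def)
    moreover have "0 \<le> norm f * (\<Sum>k<m. indicator (?slab k) y)"
      by (intro mult_nonneg_nonneg sum_nonneg) auto
    ultimately show ?thesis by linarith
  qed
  have [measurable]: "?slab k \<in> sets borel" for k by measurable
  have sl: "measure unif_ball (?slab k) \<le> K * n * (2 * \<delta>)" if "k < m" for k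
  proof -
    have "measure unif_ball (?slab k) * (1 / n) \<le> measure unif_ball (?slab k) * norm (fst (W k))"
      using steep[OF that] by (intro mult_left_mono) auto
    also have "\<dots> \<le> K * (2 * \<delta>)" using K \<delta> by simp
    finally show ?thesis using n by (simp add: field_simps)
  qed
  have "mass f (cell m W x) - mass f (cell m W' x) =
      (\<integral>y. (indicator (cell m W x) y - indicator (cell m W' x) y) * f y \<partial>unif_ball)"
    unfolding mass_def
    by (simp add: left_diff_distrib integrable_indicator_bcontfun cell_measurable)
  also have "\<bar>\<dots>\<bar> \<le> (\<integral>y. norm ((indicator (cell m W x) y - indicator (cell m W' x) y) * f y) \<partial>unif_ball)"
    unfolding real_norm_def[symmetric] by (rule integral_norm_bound)
  also have "\<dots> \<le> (\<integral>y. norm f * (\<Sum>k<m. indicator (?slab k) y) \<partial>(unif_ball :: 'a measure))"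
  proof (rule integral_mono_AE)
    show "integrable unif_ball (\<lambda>y. norm ((indicator (cell m W x) y - indicator (cell m W' x) y) * f y))"
      by (simp only: left_diff_distrib)
        (intro integrable_norm Bochner_Integration.integrable_diff integrable_indicator_bcontfun cell_measurable)
    show "integrable unif_ball (\<lambda>y. norm f * (\<Sum>k<m. indicator (?slab k) y :: real))"
      by (intro integrable_mult_right Bochner_Integration.integrable_sum integrable_unif_ball_indicator) simp
    show "AE y in unif_ball. norm ((indicator (cell m W x) y - indicator (cell m W' x) y) * f y)
        \<le> norm f * (\<Sum>k<m. indicator (?slab k) y)"
      using AE_unif_ball by eventually_elim (rule pw)
  qed
  also have "\<dots> = norm f * (\<Sum>k<m. measure unif_ball (?slab k))"
    by (subst integral_mult_right_zero, subst Bochner_Integration.integral_sum)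
      (auto intro: integrable_unif_ball_indicator)
  also have "\<dots> \<le> norm f * (\<Sum>k<m. K * n * (2 * \<delta>))"
    using sl by (intro mult_left_mono sum_mono) auto
  finally show ?thesis by simp
qed

section \<open>Bump functions and their masses\<close>

lemma unif_ball_open_pos:
  fixes U :: "'a::euclidean_space set"
  assumes "open U" "x \<in> U" "norm x < 1"
  shows "measure unif_ball U > 0"
proof -
  have "open (U \<inter> ball 0 1)" "x \<in> U \<inter> ball 0 1" using assms by auto
  then obtain e where e: "e > 0" "cball x e \<subseteq> U \<inter> ball 0 1" by (meson open_contains_cball)
  have "0 < measure lborel (cball x e)"
    using content_cball_pos[OF e(1), of x] by (simp add: measure_completion)
  also have "\<dots> \<le> measure lborel (cball 0 1 \<inter> U)"
  proof (rule measure_mono_fmeasurable)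
    show "cball 0 1 \<inter> U \<in> fmeasurable lborel"
      using assms(1) emeasure_lborel_cball_finite[of "0::'a" 1]
      by (intro fmeasurable_Int_fmeasurable fmeasurableI) auto
  qed (use e in auto)
  finally have "0 < measure lborel (cball 0 1 \<inter> U)" .
  moreover have "0 < measure lborel (cball (0::'a) 1)"
    using content_cball_pos[of 1 "0::'a"] by (simp add: measure_completion)
  ultimately show ?thesis using assms(1) by (simp add: measure_unif_ball)
qed

text \<open>A continuous substitute for the indicator of a ball, so that adding it to a density
  stays within the Banach space.\<close>

definition bump :: "'a::metric_space \<Rightarrow> real \<Rightarrow> 'a \<Rightarrow>\<^sub>C real" where
  "bump x r = Bcontfun (\<lambda>y. max 0 (min 1 (2 - 2 * dist x y / r)))"

lemma bump_apply: "bump x r y = max 0 (min 1 (2 - 2 * dist x y / r))"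
proof -
  have "continuous_on UNIV (\<lambda>y. max 0 (min 1 (2 - 2 * dist x y * inverse r)))"
    by (intro continuous_intros)
  then have "(\<lambda>y. max 0 (min 1 (2 - 2 * dist x y / r))) \<in> bcontfun"
    by (intro bcontfun_normI[of _ 1]) (auto simp: divide_inverse)
  then show ?thesis by (simp add: bump_def Bcontfun_inverse)
qed

lemma norm_bump_le: "norm (bump x r) \<le> 1"
  by (rule norm_bound) (simp add: bump_apply)

lemma bump_outside: "r > 0 \<Longrightarrow> dist x y \<ge> r \<Longrightarrow> bump x r y = 0"
  by (simp add: bump_apply field_simps)

lemma bump_inside: "r > 0 \<Longrightarrow> dist x y < r / 2 \<Longrightarrow> bump x r y = 1"
  by (simp add: bump_apply field_simps)

lemma mass_bump_inside:
  assumes "r > 0" "ball x r \<subseteq> C"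
  shows "mass (bump x r) C = mass (bump x r) UNIV"
proof -
  have "indicator C y * bump x r y = indicator UNIV y * bump x r y" for y
    using assms bump_outside[OF assms(1), of x y] by (cases "r \<le> dist x y") (auto simp: indicator_def subset_iff disjoint_iff)
  then show ?thesis unfolding mass_def by presburger
qed

lemma mass_bump_outside:
  assumes "r > 0" "ball x r \<inter> C = {}"
  shows "mass (bump x r) C = 0"
proof -
  have "indicator C y * bump x r y = 0" for y
    using assms bump_outside[OF assms(1), of x y] by (cases "r \<le> dist x y") (auto simp: indicator_def subset_iff disjoint_iff)
  then show ?thesis unfolding mass_def by (simp only: integral_zero)
qed

lemma mass_bump_pos:
  fixes x :: "'a::euclidean_space"
  assumes "r > 0" "norm x < 1"
  shows "mass (bump x r) UNIV > 0"
proof -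
  have "0 < measure unif_ball (ball x (r / 2))"
    using assms by (intro unif_ball_open_pos[of _ x]) auto
  also have "\<dots> = (\<integral>y. indicator (ball x (r / 2)) y \<partial>unif_ball)" by simp
  also have "\<dots> \<le> mass (bump x r) UNIV"
    unfolding mass_def
  proof (rule integral_mono)
    show "integrable unif_ball (indicat_real (ball x (r / 2)))"
      by (intro integrable_unif_ball_indicator) auto
    show "integrable unif_ball (\<lambda>y. indicator UNIV y * bump x r y)"
      by (intro integrable_indicator_bcontfun) auto
    show "indicat_real (ball x (r / 2)) y \<le> indicator UNIV y * bump x r y" for y
      using bump_inside[OF assms(1), of x y] by (cases "dist x y < r / 2") (auto simp: bump_apply)
  qed
  finally show ?thesis .
qed

section \<open>Coordinate estimates for pencils\<close>

lemma norm_le_DIM: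
  fixes x :: "'v::euclidean_space"
  assumes "\<And>b. b \<in> Basis \<Longrightarrow> \<bar>x \<bullet> b\<bar> \<le> h"
  shows "norm x \<le> real DIM('v) * h"
proof -
  have "norm x \<le> (\<Sum>b\<in>Basis. \<bar>x \<bullet> b\<bar>)" by (rule norm_le_l1)
  also have "\<dots> \<le> (\<Sum>b\<in>(Basis::'v set). h)" using assms by (rule sum_mono)
  finally show ?thesis by simp
qed

text \<open>The product of \<open>\<tau> k\<close> and \<open>v\<close> is bilinear, hence Lipschitz
  on bounded parameters: its two factors contribute \<open>2 * n\<close> to the constant, and
  \<open>u\<close> contributes 1.\<close>

lemma pencil_close:
  fixes u v u' v' :: "'v::euclidean_space"
  assumes h: "\<And>b. b \<in> Basis \<Longrightarrow> \<bar>u \<bullet> b - u' \<bullet> b\<bar> \<le> h" "\<And>b. b \<in> Basis \<Longrightarrow> \<bar>v \<bullet> b - v' \<bullet> b\<bar> \<le> h"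
    and t: "2 \<le> k \<Longrightarrow> \<bar>\<tau> k - \<tau>' k\<bar> \<le> h" "2 \<le> k \<Longrightarrow> \<bar>\<tau> k\<bar> \<le> n"
    and v': "\<And>b. b \<in> Basis \<Longrightarrow> \<bar>v' \<bullet> b\<bar> \<le> n" and n: "n \<ge> 0"
  shows "norm (pencil u v \<tau> k - pencil u' v' \<tau>' k) \<le> (2 * n + 1) * real DIM('v) * h"
proof -
  have h0: "h \<ge> 0" using h(1) nonempty_Basis by (meson abs_ge_zero ex_in_conv order_trans)
  let ?d = "real DIM('v)"
  have u: "norm (u - u') \<le> ?d * h" and v: "norm (v - v') \<le> ?d * h"
    using h by (auto intro!: norm_le_DIM simp: inner_diff_left)
  have nv: "norm v' \<le> ?d * n" using v' by (rule norm_le_DIM)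
  have le: "?d * h \<le> (2 * n + 1) * ?d * h"
    using n h0 mult_right_mono[of 1 "2 * n + 1" "?d * h"] by (simp add: mult.assoc)
  have u': "norm (u - u') \<le> (2 * n + 1) * ?d * h" and v1: "norm (v - v') \<le> (2 * n + 1) * ?d * h"
    using u v le by linarith+
  consider "k = 0" | "k = 1" | "k \<ge> 2" by linarith
  then show ?thesis
  proof cases
    case 3
    have "pencil u v \<tau> k - pencil u' v' \<tau>' k = (u - u') + (\<tau> k *\<^sub>R (v - v') + (\<tau> k - \<tau>' k) *\<^sub>R v')"
      using 3 by (simp add: pencil_def algebra_simps)
    also have "norm \<dots> \<le> norm (u - u') + (\<bar>\<tau> k\<bar> * norm (v - v') + \<bar>\<tau> k - \<tau>' k\<bar> * norm v')"
      by (metis (no_types, opaque_lifting) add_mono norm_scaleR norm_triangle_ineq norm_triangle_le order_refl add_left_mono)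
    also have "\<dots> \<le> ?d * h + (n * (?d * h) + h * (?d * n))"
      using u v nv t 3 n h0 by (intro add_mono mult_mono) auto
    also have "\<dots> = (2 * n + 1) * ?d * h" by (simp add: algebra_simps)
    finally show ?thesis .
  qed (use u' v1 in \<open>auto simp: pencil_def\<close>)
qed

section \<open>Balanced densities are meagre\<close>

text \<open>
  The points \<open>X i\<close> label the parts of the fan. Requiring \<open>u \<bullet> c = 1\<close> and \<open>v \<bullet> d = 1\<close> for basis vectors
  \<open>c\<close> and \<open>d\<close> is what saves two parameters; \<open>n\<close> bounds all parameters, the steepness of the affine
  functions from below and the distance of the \<open>X i\<close> from the hyperplanes.
\<close>
definition admissible ::
  "nat \<Rightarrow> real \<Rightarrow> (nat \<Rightarrow> 'a::euclidean_space) \<Rightarrow> 'a \<times> real \<Rightarrow> 'a \<times> real \<Rightarrow>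
   'a \<times> real \<Rightarrow> 'a \<times> real \<Rightarrow> (nat \<Rightarrow> real) \<Rightarrow> bool" where
  "admissible m n X c d u v \<tau> \<longleftrightarrow>
     u \<bullet> c = 1 \<and> v \<bullet> d = 1 \<and> (\<forall>b\<in>Basis. \<bar>u \<bullet> b\<bar> \<le> n \<and> \<bar>v \<bullet> b\<bar> \<le> n) \<and> (\<forall>k<m. \<bar>\<tau> k\<bar> \<le> n) \<and>
     (\<forall>k<m. norm (fst (pencil u v \<tau> k)) \<ge> 1 / n) \<and>
     (\<forall>i<2 * m. \<forall>k<m. \<bar>affval (pencil u v \<tau> k) (X i)\<bar> \<ge> 1 / n) \<and>
     (\<forall>i<2 * m. \<forall>j<2 * m. i \<noteq> j \<longrightarrow> X j \<notin> cell m (pencil u v \<tau>) (X i))"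

text \<open>The common mass \<open>T\<close> is left free because \<open>f\<close> is not
  normalised; this costs one parameter.\<close>

definition balanced ::
  "nat \<Rightarrow> real \<Rightarrow> (nat \<Rightarrow> 'a::euclidean_space) \<Rightarrow> 'a \<times> real \<Rightarrow> 'a \<times> real \<Rightarrow> ('a \<Rightarrow>\<^sub>C real) \<Rightarrow> bool" where
  "balanced m n X c d f \<longleftrightarrow>
     (\<exists>u v \<tau> T. admissible m n X c d u v \<tau> \<and> \<bar>T\<bar> \<le> n \<and>
        (\<forall>i<2 * m. mass f (cell m (pencil u v \<tau>) (X i)) = T))"

lemma cell_disjoint:
  assumes "y \<notin> cell m W x"
  shows "cell m W x \<inter> cell m W y = {}"
proof -
  obtain k where k: "k < m" "affval (W k) y * affval (W k) x \<le> 0"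
    using assms by (auto simp: cell_def not_less)
  have False if "z \<in> cell m W x" "z \<in> cell m W y" for z
    using that k by (auto simp: cell_def zero_less_mult_iff mult_le_0_iff dest!: spec[of _ k])
  then show ?thesis by blast
qed

lemma norm_pencil_le:
  fixes u v :: "'v::euclidean_space"
  assumes "\<And>b. b \<in> Basis \<Longrightarrow> \<bar>u \<bullet> b\<bar> \<le> n" "\<And>b. b \<in> Basis \<Longrightarrow> \<bar>v \<bullet> b\<bar> \<le> n" "\<bar>\<tau> k\<bar> \<le> n"
  shows "norm (pencil u v \<tau> k) \<le> (1 + n) * (real DIM('v) * n)"
proof -
  have n: "n \<ge> 0" using assms(3) by linarith
  have u: "norm u \<le> real DIM('v) * n" and v: "norm v \<le> real DIM('v) * n"
    using assms by (auto intro: norm_le_DIM)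
  have "norm (u + \<tau> k *\<^sub>R v) \<le> norm u + \<bar>\<tau> k\<bar> * norm v" by (metis norm_scaleR norm_triangle_ineq)
  also have "\<dots> \<le> real DIM('v) * n + n * (real DIM('v) * n)"
    using u v assms(3) n by (intro add_mono mult_mono) auto
  finally have "norm (u + \<tau> k *\<^sub>R v) \<le> (1 + n) * (real DIM('v) * n)" by (simp add: algebra_simps)
  moreover have "real DIM('v) * n \<le> (1 + n) * (real DIM('v) * n)"
    using n mult_right_mono[of 1 "1 + n" "real DIM('v) * n"] by simp
  ultimately have "norm u \<le> (1 + n) * (real DIM('v) * n)" "norm v \<le> (1 + n) * (real DIM('v) * n)"
    "norm (u + \<tau> k *\<^sub>R v) \<le> (1 + n) * (real DIM('v) * n)"
    using u v by linarith+
  then show ?thesis unfolding pencil_def by presburger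
qed

text \<open>On the ball each affine function moves by at most \<open>R * r\<close>, too little to
  reach zero from its value at \<open>x\<close>. The radius depends only on \<open>R\<close> and
  \<open>s\<close>, so one choice serves all admissible fans at once.\<close>

lemma ball_subset_cell:
  assumes R: "\<And>k. k < m \<Longrightarrow> norm (W k) \<le> R" and s: "\<And>k. k < m \<Longrightarrow> \<bar>affval (W k) x\<bar> \<ge> s"
    and r: "R * r < s" "r > 0"
  shows "ball x r \<subseteq> cell m W x"
proof
  fix y assume y: "y \<in> ball x r"
  have "affval (W k) y * affval (W k) x > 0" if k: "k < m" for k
  proof -
    have "\<bar>fst (W k) \<bullet> (y - x)\<bar> \<le> norm (fst (W k)) * norm (y - x)" by (rule Cauchy_Schwarz_ineq2)
    also have "\<dots> \<le> R * r"
      using y R[OF k] norm_fst_le[of "fst (W k)" "snd (W k)"]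
      by (intro mult_mono) (auto simp: dist_norm norm_minus_commute intro: order_trans[OF norm_ge_zero])
    finally have "\<bar>affval (W k) y - affval (W k) x\<bar> \<le> R * r"
      by (simp add: affval_def inner_diff_right)
    then show ?thesis using s[OF k] r by (auto simp: zero_less_mult_iff)
  qed
  then show "y \<in> cell m W x" by (simp add: cell_def)
qed

text \<open>Adding bumps with heights \<open>s j\<close> to \<open>f\<close> shifts the masses of
  the parts independently, and balance forces \<open>s\<close> to be a value of the map
  \<open>g\<close> of the parameters. Some small \<open>s\<close> keeps a distance
  \<open>\<rho>\<close> from all these values. This margin also excludes balanced densities close to
  the shifted one, which deals with the closure.\<close>

lemma balanced_nowhere_dense:
  fixes X :: "nat \<Rightarrow> 'a::euclidean_space"
  assumes m: "m \<ge> 2 * DIM('a)" and n: "n > 0" and X: "\<And>i. i < 2 * m \<Longrightarrow> norm (X i) < 1"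
    and cd: "c \<in> Basis" "d \<in> Basis"
  shows "interior (closure {f. balanced m (real n) X c d f}) = {}"
proof (rule ccontr)
  assume "\<not> ?thesis"
  then obtain f where "f \<in> interior (closure {f. balanced m (real n) X c d f})" by blast
  then obtain e where e: "e > 0" "ball f e \<subseteq> closure {f. balanced m (real n) X c d f}"
    by (auto simp: mem_interior)
  obtain K where K: "K > 0" "\<And>(w::'a \<times> real) \<delta>. \<delta> > 0 \<Longrightarrow> measure unif_ball {x. \<bar>affval w x\<bar> \<le> \<delta>} * norm (fst w) \<le> K * \<delta>"
    using unif_ball_slab by blast
  have m2: "m \<ge> 2" using m DIM_positive[where 'a='a] by linarith
  define N where "N = real n"
  have N: "N > 0" using n by (simp add: N_def)
  define R where "R = (1 + N) * (real DIM('a \<times> real) * N)"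
  have R: "R > 0" unfolding R_def using N by (intro mult_pos_pos) auto
  \<comment> \<open>With this radius \<open>R * r\<close> is half of the margin \<open>1 / N\<close>
    that the labels keep from zero.\<close>
  define r where "r = 1 / (2 * N * R)"
  have r: "r > 0" "R * r < 1 / N" using N R by (auto simp: r_def field_simps)
  define \<kappa> where "\<kappa> j = mass (bump (X j) r) UNIV" for j
  define \<gamma> where "\<gamma> = Min (\<kappa> ` {..<2 * m})"
  have \<kappa>: "\<kappa> j > 0" if "j < 2 * m" for j unfolding \<kappa>_def using mass_bump_pos[OF r(1)] X[OF that] .
  have \<gamma>: "\<gamma> > 0" "\<And>j. j < 2 * m \<Longrightarrow> \<gamma> \<le> \<kappa> j"
    unfolding \<gamma>_def using \<kappa> m2 by (subst Min_gr_iff) (auto simp: lessThan_empty_iff)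
  define B where "B = (2 * N + 1) * real DIM('a \<times> real)"
  have B: "B > 0" unfolding B_def using N by (intro mult_pos_pos) auto
  define A0 where "A0 = norm f * (real m * (K * N * (2 * B)))"
  have A0: "A0 \<ge> 0" unfolding A0_def using K N B by (intro mult_nonneg_nonneg) auto
  define Cell where "Cell u v \<tau> j = cell m (pencil u v \<tau>) (X j)" for u v \<tau> j
  define S where "S = {(u, v, \<tau>, T). admissible m N X c d u v \<tau> \<and> \<bar>T\<bar> \<le> N}"
  \<comment> \<open>The coordinates of \<open>u\<close> and \<open>v\<close> that are not fixed to
    1, the slots \<open>2..m-1\<close> for \<open>\<tau>\<close>, and slot \<open>m\<close> for
    \<open>T\<close>. With \<open>d\<close> the dimension of the space these are
    \<open>d + d + (m - 1)\<close>, fewer than \<open>2 * m\<close> because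
    \<open>m \<ge> 2 * d\<close>.\<close>
  define I where "I = ((Basis - {c}) <+> (Basis - {d})) <+> {2..m}"
  define co where "co i = (\<lambda>(u, v, \<tau>, T). case i of Inl (Inl b) \<Rightarrow> u \<bullet> b | Inl (Inr b) \<Rightarrow> v \<bullet> b
      | Inr k \<Rightarrow> if k = m then T else \<tau> k)" for i :: "('a \<times> real + 'a \<times> real) + nat"
  \<comment> \<open>The height of bump \<open>j\<close> that would bring the mass of part
    \<open>j\<close> from its value under \<open>f\<close> to \<open>T\<close>.\<close>
  define g where "g j = (\<lambda>(u, v, \<tau>, T). (T - mass f (Cell u v \<tau> j)) / \<kappa> j)" for j
  \<comment> \<open>The \<open>2 * m\<close> bumps have norm at most 1, so heights up to
    \<open>e / (4 * m)\<close> change \<open>f\<close> by at most \<open>e / 2\<close>. The bound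
    \<open>1 / (2 * B * N)\<close> on \<open>h\<close> gives \<open>2 * (B * h) < 1 / N\<close>, the
    separation of labels and hyperplanes that \<open>mass_cell_close\<close> asks for.\<close>
  have "\<exists>s \<rho>. (\<forall>j<2 * m. 0 \<le> s j \<and> s j \<le> e / (4 * real m)) \<and> \<rho> > 0 \<and>
      (\<forall>p\<in>S. \<exists>j<2 * m. \<bar>s j - g j p\<bar> \<ge> \<rho>)"
  proof (rule lipschitz_image_misses_box[where co = co and I = I and b = n and ?h0.0 = "1 / (2 * B * N)" and A = "(1 + A0) / \<gamma>"])
    show "finite I" by (simp add: I_def)
    show "card I < 2 * m" using m m2 cd by (simp add: I_def card_Plus card_Diff_singleton)
    show "1 / (2 * B * N) > 0" using B N by simp
    show "e / (4 * real m) > 0" using e m2 by simp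
    show "\<bar>co i p\<bar> \<le> real n" if "p \<in> S" "i \<in> I" for p i
      using that by (auto simp: S_def I_def co_def admissible_def N_def split: sum.splits)
    fix p p' h j
    assume p: "p \<in> S" "p' \<in> S" and h: "0 < h" "h < 1 / (2 * B * N)"
      and close: "\<And>i. i \<in> I \<Longrightarrow> \<bar>co i p - co i p'\<bar> \<le> h" and j: "j < 2 * m"
    obtain u v \<tau> T where p1: "p = (u, v, \<tau>, T)" by (cases p) auto
    obtain u' v' \<tau>' T' where p2: "p' = (u', v', \<tau>', T')" by (cases p') auto
    have ad: "admissible m N X c d u v \<tau>" "admissible m N X c d u' v' \<tau>'"
      using p by (auto simp: p1 p2 S_def)
    \<comment> \<open>The coordinate left out of \<open>I\<close> equals 1 for both
      parameters.\<close>
    have cu: "\<bar>u \<bullet> b - u' \<bullet> b\<bar> \<le> h" if "b \<in> Basis" for b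
      using close[of "Inl (Inl b)"] that ad h
      by (cases "b = c") (auto simp: I_def co_def p1 p2 admissible_def)
    have cv: "\<bar>v \<bullet> b - v' \<bullet> b\<bar> \<le> h" if "b \<in> Basis" for b
      using close[of "Inl (Inr b)"] that ad h
      by (cases "b = d") (auto simp: I_def co_def p1 p2 admissible_def)
    have ct: "\<bar>\<tau> k - \<tau>' k\<bar> \<le> h" if "2 \<le> k" "k < m" for k
    proof -
      have "Inr k \<in> I" using that by (simp add: I_def InrI)
      then show ?thesis using close[of "Inr k"] that by (simp add: co_def p1 p2)
    qed
    have cT: "\<bar>T - T'\<bar> \<le> h"
    proof -
      have "Inr m \<in> I" using m2 by (simp add: I_def InrI)
      then show ?thesis using close[of "Inr m"] by (simp add: co_def p1 p2)
    qed
    have "\<bar>mass f (Cell u v \<tau> j) - mass f (Cell u' v' \<tau>' j)\<bar>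
        \<le> norm f * (real m * (K * N * (2 * (B * h))))"
      unfolding Cell_def
    proof (rule mass_cell_close[OF K(2)])
      show "norm (pencil u v \<tau> k - pencil u' v' \<tau>' k) \<le> B * h" if "k < m" for k
        unfolding B_def using cu cv ct that ad N by (intro pencil_close) (auto simp: admissible_def)
      have "2 * (B * h) < 1 / N" using h B N by (simp add: field_simps)
      then show "2 * (B * h) < \<bar>affval (pencil u v \<tau> k) (X j)\<bar>" if "k < m" for k
        using ad(1) j that unfolding admissible_def by (meson less_le_trans)
      show "norm (X j) \<le> 1" using X[OF j] by simp
      show "1 / N \<le> norm (fst (pencil u v \<tau> k))" if "k < m" for k
        using ad(1) that by (simp add: admissible_def)
    qed (use B h N in auto)
    then have "\<bar>(T - mass f (Cell u v \<tau> j)) - (T' - mass f (Cell u' v' \<tau>' j))\<bar> \<le> h + A0 * h"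
      using cT by (simp add: A0_def algebra_simps)
    then have "\<bar>g j p - g j p'\<bar> \<le> (h + A0 * h) / \<kappa> j"
      using \<kappa>[OF j] by (simp add: g_def p1 p2 abs_divide divide_right_mono flip: diff_divide_distrib)
    also have "\<dots> \<le> (h + A0 * h) / \<gamma>"
      using \<gamma>(1) \<gamma>(2)[OF j] A0 h by (intro divide_left_mono) auto
    finally show "\<bar>g j p - g j p'\<bar> \<le> (1 + A0) / \<gamma> * h" by (simp add: algebra_simps)
  qed
  then obtain s \<rho> where s: "\<And>j. j < 2 * m \<Longrightarrow> 0 \<le> s j" "\<And>j. j < 2 * m \<Longrightarrow> s j \<le> e / (4 * real m)"
    and \<rho>: "\<rho> > 0" "\<And>p. p \<in> S \<Longrightarrow> \<exists>j<2 * m. \<bar>s j - g j p\<bar> \<ge> \<rho>"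
    by blast
  define f' where "f' = f + (\<Sum>j<2 * m. s j *\<^sub>R bump (X j) r)"
  have "norm (\<Sum>j<2 * m. s j *\<^sub>R bump (X j) r) \<le> (\<Sum>j<2 * m. e / (4 * real m))"
  proof (rule sum_norm_le)
    fix j assume "j \<in> {..<2 * m}"
    then have "\<bar>s j\<bar> * norm (bump (X j) r) \<le> e / (4 * real m) * 1"
      using s[of j] norm_bump_le[of "X j" r] by (intro mult_mono) auto
    then show "norm (s j *\<^sub>R bump (X j) r) \<le> e / (4 * real m)" by simp
  qed
  also have "\<dots> < e" using e m2 by simp
  finally have "f' \<in> ball f e" by (simp add: f'_def dist_norm)
  then have "f' \<in> closure {f. balanced m (real n) X c d f}" using e by blast
  \<comment> \<open>Masses move by at most the norm distance of the densities; divided by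
    \<open>\<kappa> j \<ge> \<gamma>\<close>, an error below \<open>\<rho> * \<gamma>\<close> stays
    below \<open>\<rho>\<close>.\<close>
  moreover have "\<rho> * \<gamma> > 0" using \<rho> \<gamma> by simp
  ultimately obtain f'' where f'': "balanced m N X c d f''" "dist f'' f' < \<rho> * \<gamma>"
    unfolding closure_approachable N_def by blast
  then obtain u v \<tau> T where ad: "admissible m N X c d u v \<tau>" and T: "\<bar>T\<bar> \<le> N"
    and bal: "\<And>i. i < 2 * m \<Longrightarrow> mass f'' (Cell u v \<tau> i) = T"
    unfolding balanced_def Cell_def by blast
  have "\<bar>s j - g j (u, v, \<tau>, T)\<bar> < \<rho>" if j: "j < 2 * m" for j
  proof -
    have ball: "ball (X i) r \<subseteq> Cell u v \<tau> i" if "i < 2 * m" for i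
      unfolding Cell_def
    proof (rule ball_subset_cell[OF _ _ r(2) r(1)])
      show "norm (pencil u v \<tau> k) \<le> R" if "k < m" for k
        unfolding R_def using ad that by (intro norm_pencil_le) (auto simp: admissible_def)
      show "1 / N \<le> \<bar>affval (pencil u v \<tau> k) (X i)\<bar>" if "k < m" for k
        using ad that \<open>i < 2 * m\<close> by (auto simp: admissible_def)
    qed
    \<comment> \<open>Each bump is supported in its own part and misses the others, so the heights
      act diagonally on the masses.\<close>
    have mb: "mass (bump (X i) r) (Cell u v \<tau> j) = (if i = j then \<kappa> j else 0)" if i: "i < 2 * m" for i
    proof (cases "i = j")
      case True
      then show ?thesis using mass_bump_inside[OF r(1) ball[OF j]] by (simp add: \<kappa>_def)
    next
      case False
      then have "X j \<notin> cell m (pencil u v \<tau>) (X i)" using ad i j by (auto simp: admissible_def)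
      then have "Cell u v \<tau> i \<inter> Cell u v \<tau> j = {}" unfolding Cell_def by (rule cell_disjoint)
      then have "ball (X i) r \<inter> Cell u v \<tau> j = {}" using ball[OF i] by blast
      then show ?thesis using mass_bump_outside[OF r(1)] False by simp
    qed
    have bC: "Cell u v \<tau> j \<in> sets borel" by (simp add: Cell_def cell_measurable)
    have "mass f' (Cell u v \<tau> j) = mass f (Cell u v \<tau> j) + (\<Sum>i<2 * m. s i * mass (bump (X i) r) (Cell u v \<tau> j))"
      using bC by (simp add: f'_def mass_add mass_sum mass_scaleR)
    also have "(\<Sum>i<2 * m. s i * mass (bump (X i) r) (Cell u v \<tau> j)) = (\<Sum>i<2 * m. if i = j then s j * \<kappa> j else 0)"
      using mb by (intro sum.cong) auto
    also have "\<dots> = s j * \<kappa> j" using j by simp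
    finally have f'C: "mass f' (Cell u v \<tau> j) = mass f (Cell u v \<tau> j) + s j * \<kappa> j" .
    have "\<bar>T - mass f' (Cell u v \<tau> j)\<bar> = \<bar>mass (f'' - f') (Cell u v \<tau> j)\<bar>"
      using bal[OF j] bC by (simp add: mass_diff)
    also have "\<dots> \<le> norm (f'' - f')" using bC by (rule abs_mass_le)
    also have "\<dots> < \<rho> * \<gamma>" using f''(2) by (simp add: dist_norm)
    also have "\<dots> \<le> \<rho> * \<kappa> j" using \<rho> \<gamma>(2)[OF j] by simp
    finally have *: "\<bar>T - (mass f (Cell u v \<tau> j) + s j * \<kappa> j)\<bar> < \<rho> * \<kappa> j" by (simp add: f'C)
    have "s j - g j (u, v, \<tau>, T) = - (T - (mass f (Cell u v \<tau> j) + s j * \<kappa> j)) / \<kappa> j"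
      using \<kappa>[OF j] by (simp add: g_def field_simps)
    then show ?thesis using * \<kappa>[OF j] by (simp add: abs_divide pos_divide_less_eq)
  qed
  moreover have "(u, v, \<tau>, T) \<in> S" using ad T by (simp add: S_def)
  ultimately show False using \<rho>(2) by (meson not_le)
qed

section \<open>From meagreness to the measure\<close>

text \<open>An open set that misses the open ball also misses its closure, and the uniform measure
  lives on the closed ball.\<close>

lemma mass_outside_ball:
  assumes "open C" "C \<inter> ball 0 1 = {}"
  shows "mass f C = 0"
proof -
  have "C \<inter> cball 0 1 = {}"
    using open_Int_closure_eq_empty[OF assms(1), of "ball 0 1"] assms(2) by simp
  then have zero: "indicator C y * f y = 0" if "norm y \<le> 1" for y using that by (auto simp: indicator_def)
  have "AE y in unif_ball. indicator C y * f y = 0"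
    using AE_unif_ball by eventually_elim (rule zero)
  then show ?thesis unfolding mass_def by (rule integral_eq_zero_AE)
qed

text \<open>By Baire's theorem the closures of the countably many nowhere dense sets cannot cover
  the ball of radius 1 around the constant 2. Every density in that ball is at least 1.\<close>

lemma exists_unbalanced:
  fixes D :: "'a::euclidean_space set"
  assumes m: "m \<ge> 2 * DIM('a)" and D: "countable D"
  shows "\<exists>f :: 'a \<Rightarrow>\<^sub>C real. (\<forall>x. apply_bcontfun f x \<ge> 1) \<and>
    (\<forall>X n c d. (\<forall>i<2 * m. X i \<in> D \<and> norm (X i) < 1) \<and> n > 0 \<and> c \<in> Basis \<and> d \<in> Basis \<longrightarrow>
      \<not> balanced m (real n) X c d f)"
proof -
  \<comment> \<open>Labels are indexed by lists of length \<open>2 * m\<close>, since functions from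
    \<open>nat\<close> to \<open>D\<close> need not form a countable set.\<close>
  define Ls where "Ls = {xs \<in> lists D. length xs = 2 * m \<and> (\<forall>x\<in>set xs. norm x < 1)}"
  define J where "J = Ls \<times> {n::nat. n > 0} \<times> (Basis :: ('a \<times> real) set) \<times> (Basis :: ('a \<times> real) set)"
  define E where "E = (\<lambda>(xs :: 'a list, n, c, d). closure {f. balanced m (real n) (nth xs) c d f})"
  have "countable Ls"
    unfolding Ls_def by (rule countable_subset[OF _ countable_lists[OF D]]) auto
  then have "countable J"
    unfolding J_def by (intro countable_SIGMA) (auto intro: countable_finite)
  have "euclidean interior_of \<Union> (E ` J) = {}"
  proof (rule Baire_category_alt)
    show "completely_metrizable_space (euclidean :: ('a \<Rightarrow>\<^sub>C real) topology) \<or>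
        locally_compact_space (euclidean :: ('a \<Rightarrow>\<^sub>C real) topology) \<and> regular_space (euclidean :: ('a \<Rightarrow>\<^sub>C real) topology)"
      by (simp add: completely_metrizable_space_euclidean)
    show "countable (E ` J)" using \<open>countable J\<close> by simp
    fix T assume "T \<in> E ` J"
    then obtain xs n c d where T: "T = closure {f. balanced m (real n) (nth xs) c d f}"
      and *: "xs \<in> Ls" "n > 0" "c \<in> Basis" "d \<in> Basis"
      by (auto simp: E_def J_def)
    have "interior T = {}"
      unfolding T using * by (intro balanced_nowhere_dense m) (auto simp: Ls_def)
    then show "closedin euclidean T \<and> euclidean interior_of T = {}"
      by (simp add: T)
  qed
  then have "interior (\<Union> (E ` J)) = {}" by simp
  then have "\<not> ball (const_bcontfun 2) 1 \<subseteq> \<Union> (E ` J)"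
    by (metis ball_eq_empty interior_maximal open_ball subset_empty not_one_le_zero)
  then obtain f where f: "f \<in> ball (const_bcontfun 2) 1" "f \<notin> \<Union> (E ` J)" by blast
  have "f x \<ge> 1" for x
    using dist_fun_lt_imp_dist_val_lt[of "const_bcontfun 2" f 1 x] f(1)
    by (simp add: dist_real_def)
  moreover have "\<not> balanced m (real n) X c d f"
    if X: "\<forall>i<2 * m. X i \<in> D \<and> norm (X i) < 1" and n: "n > 0" and cd: "c \<in> Basis" "d \<in> Basis" for X n c d
  proof
    assume bal: "balanced m (real n) X c d f"
    define xs where "xs = map X [0..<2 * m]"
    have "balanced m (real n) (nth xs) c d f"
      using bal unfolding balanced_def admissible_def by (simp add: xs_def cong: conj_cong)
    then have "f \<in> E (xs, n, c, d)" unfolding E_def using closure_subset by fastforce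
    moreover have "(xs, n, c, d) \<in> J" using X n cd by (auto simp: J_def Ls_def xs_def)
    ultimately show False using f(2) by blast
  qed
  ultimately show ?thesis by blast
qed

text \<open>Each part has positive mass, so it is an open set meeting the unit ball and contains a
  label from the dense set \<open>D\<close>. Finitely many positive quantities then admit one common
  bound \<open>n\<close>.\<close>

lemma equipartition_balanced:
  fixes f :: "'a::euclidean_space \<Rightarrow>\<^sub>C real"
  assumes D: "\<And>U. open U \<Longrightarrow> U \<noteq> {} \<Longrightarrow> \<exists>x\<in>D. x \<in> U" and m: "m \<ge> 2" and fan: "is_fan m H"
    and card: "card (components (UNIV - \<Union>H)) = 2 * m"
    and T: "T > 0" "\<And>C. C \<in> components (UNIV - \<Union>H) \<Longrightarrow> mass f C = T"
  shows "\<exists>X n c d. (\<forall>i<2 * m. X i \<in> D \<and> norm (X i) < 1) \<and> n > 0 \<and> c \<in> Basis \<and> d \<in> Basis \<and>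
    balanced m (real n) X c d f"
proof -
  obtain u v \<tau> c d where cd: "c \<in> Basis" "d \<in> Basis" "u \<bullet> c = 1" "v \<bullet> d = 1"
    and nz: "\<And>k. k < m \<Longrightarrow> fst (pencil u v \<tau> k) \<noteq> 0"
    and H: "H = (\<lambda>k. {x. affval (pencil u v \<tau> k) x = 0}) ` {..<m}"
    using fan_as_pencil[OF fan m] by blast
  define W where "W = pencil u v \<tau>"
  define Cs where "Cs = components (UNIV - \<Union>H)"
  have Cs: "Cs = components (UNIV - (\<Union>k<m. {x. affval (W k) x = 0}))"
    by (simp add: Cs_def H W_def)
  have cell: "C = cell m W x" if "C \<in> Cs" "x \<in> C" for C x
    using that unfolding Cs by (rule component_eq_cell)
  have ex: "\<exists>x. x \<in> D \<and> norm x < 1 \<and> x \<in> C" if C: "C \<in> Cs" for C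
  proof -
    obtain x where "x \<in> C" using C in_components_nonempty unfolding Cs_def by blast
    then have "open C" using cell[OF C] open_cell by metis
    moreover have "mass f C \<noteq> 0" using T C by (simp add: Cs_def)
    ultimately have "C \<inter> ball 0 1 \<noteq> {}" using mass_outside_ball by blast
    then obtain y where "y \<in> D" "y \<in> C \<inter> ball 0 1" using D[of "C \<inter> ball 0 1"] \<open>open C\<close> by blast
    then show ?thesis by auto
  qed
  have "finite Cs" using card m by (intro card_ge_0_finite) (simp add: Cs_def)
  then obtain e where e: "bij_betw e {0..<2 * m} Cs"
    using ex_bij_betw_nat_finite card unfolding Cs_def by metis
  have eC: "e i \<in> Cs" if "i < 2 * m" for i using e that by (auto simp: bij_betw_def)
  have "\<forall>i. \<exists>x. i < 2 * m \<longrightarrow> x \<in> D \<and> norm x < 1 \<and> x \<in> e i" using ex eC by blast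
  then obtain X where X: "\<And>i. i < 2 * m \<Longrightarrow> X i \<in> D \<and> norm (X i) < 1 \<and> X i \<in> e i" by metis
  have cX: "e i = cell m W (X i)" if "i < 2 * m" for i using cell[OF eC[OF that]] X[OF that] by blast
  have sep: "X j \<notin> cell m W (X i)" if "i < 2 * m" "j < 2 * m" "i \<noteq> j" for i j
  proof
    assume "X j \<in> cell m W (X i)"
    then have "e i = e j" using cX that cell[OF eC[OF that(1)]] by metis
    then show False using e that by (auto simp: bij_betw_def dest: inj_onD)
  qed
  have away: "affval (W k) (X i) \<noteq> 0" if "i < 2 * m" "k < m" for i k
    using in_components_subset[OF eC[OF that(1), unfolded Cs]] X[OF that(1)] that by auto
  \<comment> \<open>All quantities to be bounded by \<open>n\<close>; lower bounds enter through
    reciprocals. Passing to \<open>Suc n\<close> below makes the bound positive.\<close>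
  define V where "V = insert T ((\<lambda>b. \<bar>u \<bullet> b\<bar>) ` Basis \<union> (\<lambda>b. \<bar>v \<bullet> b\<bar>) ` Basis \<union> (\<lambda>k. \<bar>\<tau> k\<bar>) ` {..<m} \<union>
    (\<lambda>k. 1 / norm (fst (W k))) ` {..<m} \<union> (\<lambda>(i, k). 1 / \<bar>affval (W k) (X i)\<bar>) ` ({..<2 * m} \<times> {..<m}))"
  have "finite V" by (simp add: V_def)
  then obtain n where n: "Max V \<le> real n" using real_arch_simple by blast
  have nV: "x \<le> real (Suc n)" if "x \<in> V" for x using Max_ge[OF \<open>finite V\<close> that] n by simp
  have inv: "1 / real (Suc n) \<le> a" if "1 / a \<in> V" "a > 0" for a :: real
    using nV[OF that(1)] that(2) by (simp add: field_simps)
  have "admissible m (real (Suc n)) X c d u v \<tau>"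
    unfolding admissible_def W_def[symmetric]
  proof (intro conjI ballI allI impI)
    show "\<bar>u \<bullet> b\<bar> \<le> real (Suc n)" "\<bar>v \<bullet> b\<bar> \<le> real (Suc n)" if "b \<in> Basis" for b
      using that by (auto intro!: nV simp: V_def simp del: of_nat_Suc)
    show "\<bar>\<tau> k\<bar> \<le> real (Suc n)" if "k < m" for k
      using that by (auto intro!: nV simp: V_def simp del: of_nat_Suc)
    show "1 / real (Suc n) \<le> norm (fst (W k))" if "k < m" for k
      using that nz[OF that] by (intro inv) (auto simp: V_def W_def)
    show "1 / real (Suc n) \<le> \<bar>affval (W k) (X i)\<bar>" if "i < 2 * m" "k < m" for i k
      using that away[OF that] by (intro inv) (auto simp: V_def)
  qed (use cd sep in auto)
  moreover have "\<bar>T\<bar> \<le> real (Suc n)" using T(1) nV[of T] by (simp add: V_def)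
  moreover have "mass f (cell m W (X i)) = T" if "i < 2 * m" for i
    using T(2) eC[OF that] cX[OF that] by (simp add: Cs_def)
  ultimately have "balanced m (real (Suc n)) X c d f"
    unfolding balanced_def W_def by blast
  then show ?thesis using X cd(1,2) zero_less_Suc by blast
qed

theorem theorem8:
  fixes m :: nat
  assumes "DIM('a::euclidean_space) \<ge> 2"
    and "m \<ge> 2 * DIM('a)"
  shows "\<exists>\<mu> :: 'a measure.
           sets \<mu> = sets borel \<and> prob_space \<mu> \<and> absolutely_continuous lborel \<mu> \<and>
           (\<forall>H. is_fan m H \<longrightarrow> \<not> fan_equipartitions \<mu> m H)"
proof -
  have m2: "m \<ge> 2" using assms by linarith
  obtain D :: "'a set" where D: "countable D" "\<And>U. open U \<Longrightarrow> U \<noteq> {} \<Longrightarrow> \<exists>x\<in>D. x \<in> U"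
    using countable_dense_setE by blast
  obtain f :: "'a \<Rightarrow>\<^sub>C real" where f: "\<And>x. f x \<ge> 1"
    and unbal: "\<And>X n c d. (\<forall>i<2 * m. X i \<in> D \<and> norm (X i) < 1) \<Longrightarrow> n > 0 \<Longrightarrow> c \<in> Basis \<Longrightarrow> d \<in> Basis \<Longrightarrow>
      \<not> balanced m (real n) X c d f"
    using exists_unbalanced[OF assms(2) D(1)] by blast
  have f0: "f x \<ge> 0" for x using f[of x] by linarith
  have [measurable]: "apply_bcontfun f \<in> borel_measurable borel"
    by (intro borel_measurable_continuous_onI continuous_on_apply_bcontfun)
  define Z where "Z = mass f UNIV"
  have "1 = mass (const_bcontfun 1) (UNIV :: 'a set)"
    using unif_ball.prob_space[where 'a='a] by (simp add: mass_def)
  also have "\<dots> \<le> Z"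
    unfolding Z_def mass_def using f by (intro integral_mono integrable_indicator_bcontfun) auto
  finally have Z: "Z > 0" by simp
  \<comment> \<open>Only here is the density normalised. Equal parts for \<open>\<mu>\<close> then
    mean that every part has mass \<open>Z / (2 * m)\<close> under \<open>f\<close>, the common
    value \<open>T\<close> of a balanced density.\<close>
  define \<mu> where "\<mu> = density unif_ball (\<lambda>x. ennreal (f x / Z))"
  have em: "emeasure \<mu> C = ennreal (mass f C / Z)" if C: "C \<in> sets borel" for C
  proof -
    have "emeasure \<mu> C = (\<integral>\<^sup>+x. ennreal (f x / Z) * indicator C x \<partial>unif_ball)"
      unfolding \<mu>_def using C by (intro emeasure_density) auto
    also have "\<dots> = (\<integral>\<^sup>+x. ennreal (indicator C x * f x / Z) \<partial>unif_ball)"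
      by (intro nn_integral_cong) (auto simp: indicator_def)
    also have "\<dots> = ennreal (\<integral>x. indicator C x * f x / Z \<partial>unif_ball)"
      using C Z f0 by (intro nn_integral_eq_integral integrable_divide integrable_indicator_bcontfun) auto
    finally show ?thesis by (simp add: mass_def)
  qed
  have mass_nonneg: "mass f C \<ge> 0" for C
    unfolding mass_def using f0 by (intro Bochner_Integration.integral_nonneg) auto
  have sets: "sets \<mu> = sets borel" by (simp add: \<mu>_def)
  moreover have "prob_space \<mu>"
  proof
    show "emeasure \<mu> (space \<mu>) = 1"
      using em[of UNIV] Z by (simp add: Z_def[symmetric] sets_eq_imp_space_eq[OF sets])
  qed
  moreover have "absolutely_continuous lborel \<mu>"
  proof -
    have "absolutely_continuous lborel (unif_ball :: 'a measure)"
      unfolding absolutely_continuous_def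
    proof
      fix A :: "'a set" assume A: "A \<in> null_sets lborel"
      then have "cball 0 1 \<inter> A \<in> null_sets lborel" by (intro null_set_Int1) auto
      then show "A \<in> null_sets unif_ball" using A by (auto simp: null_sets_def)
    qed
    moreover have "absolutely_continuous unif_ball \<mu>"
      unfolding \<mu>_def by (intro absolutely_continuousI_density) auto
    ultimately show ?thesis unfolding absolutely_continuous_def by (rule order_trans)
  qed
  moreover have "\<not> fan_equipartitions \<mu> m H" if fan: "is_fan m H" for H
  proof
    assume eq: "fan_equipartitions \<mu> m H"
    have "closed (\<Union>H)"
      using fan by (intro closed_Union) (auto simp: is_fan_def hyperplane_def closed_hyperplane)
    then have "C \<in> sets borel" if "C \<in> components (UNIV - \<Union>H)" for C
      using that open_components[of "UNIV - \<Union>H" C] by (simp add: open_Diff)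
    then have "mass f C = Z / (2 * real m)" if "C \<in> components (UNIV - \<Union>H)" for C
      using eq that em[of C] mass_nonneg[of C] Z
      unfolding fan_equipartitions_def measure_def by (auto simp: field_simps)
    then have "\<exists>X n c d. (\<forall>i<2 * m. X i \<in> D \<and> norm (X i) < 1) \<and> n > 0 \<and> c \<in> Basis \<and> d \<in> Basis \<and>
        balanced m (real n) X c d f"
      using eq Z m2 by (intro equipartition_balanced[OF D(2) m2 fan, of "Z / (2 * real m)"])
        (auto simp: fan_equipartitions_def)
    then show False using unbal by blast
  qed
  ultimately show ?thesis by blast
qed

end
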